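(* Over an alphabet containing at least three distinct characters, there exists an infinite family of strings $T$ (of unboundedly large length and size $\mathsf{e}(T)$) such that, for a character $b$, $\mathsf{e}(bT) - \mathsf{e}(T) = \mathsf{e}(T) - 2$. Consequently the worst-case additive sensitivity of the CDAWG size under left-end insertion is at least $\mathsf{e}-2$.
   Context: Strings are finite sequences of characters from an alphabet $\Sigma$; $\varepsilon$ is the empty string. For a string $T$, $\mathrm{Substr}(T)$ is its set of substrings (including $\varepsilon$). A substring $u$ of $T$ is left-maximal in $T$ if $u$ is a prefix of $T$ or there are distinct characters $c \neq d$ with $cu, du \in \mathrm{Substr}(T)$; it is right-maximal in $T$ if $u$ is a suffix of $T$ or there are distinct characters $c\neq d$ with $uc, ud \in \mathrm{Substr}(T)$. $\mathsf{M}(T)$ is the set of substrings of $T$ that are both left- and right-maximal (it contains $\varepsilon$ and $T$). The compact directed acyclic word graph $\mathrm{CDAWG}(T)$ has exactly one node for each element of $\mathsf{M}(T)$, and the outgoing edges of the node $x$ are in bijection with the characters $c$ such that $xc \in \mathrm{Substr}(T)$. For a string $w$, $d_T(w)$ is the number of distinct characters $c$ with $wc \in \mathrm{Substr}(T)$. The size of the CDAWG is $\mathsf{e}(T) = \sum_{x \in \mathsf{M}(T)} d_T(x)$, its number of edges. *)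

theory Defs
  imports Complex_Main "HOL-Library.Sublist"
begin

definition Substr :: "'a list \<Rightarrow> 'a list set" where
  "Substr T = {u. sublist u T}"

definition left_maximal :: "'a list \<Rightarrow> 'a list \<Rightarrow> bool" where
  "left_maximal T u \<longleftrightarrow>
     u \<in> Substr T \<and>
     (prefix u T \<or> (\<exists>c d. c \<noteq> d \<and> c # u \<in> Substr T \<and> d # u \<in> Substr T))"

definition right_maximal :: "'a list \<Rightarrow> 'a list \<Rightarrow> bool" where
  "right_maximal T u \<longleftrightarrow>
     u \<in> Substr T \<and>
     (suffix u T \<or> (\<exists>c d. c \<noteq> d \<and> u @ [c] \<in> Substr T \<and> u @ [d] \<in> Substr T))"

definition maximal_substrs :: "'a list \<Rightarrow> 'a list set" where
  "maximal_substrs T = {u. left_maximal T u \<and> right_maximal T u}"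

definition out_degree :: "'a list \<Rightarrow> 'a list \<Rightarrow> nat" where
  "out_degree T w = card {c. w @ [c] \<in> Substr T}"

definition cdawg_size :: "'a list \<Rightarrow> nat" where
  "cdawg_size T = (\<Sum>x\<in>maximal_substrs T. out_degree T x)"

text \<open>
  The increases in CDAWG size over all strings of length \<open>n\<close> over \<open>\<Sigma>\<close> and all
  characters of \<open>\<Sigma>\<close> inserted at the left end. The difference is taken in the integers. The
  finiteness lemma below makes the maximum meaningful even for infinite \<open>\<Sigma>\<close>.
\<close>

definition left_insertion_increases :: "'a set \<Rightarrow> nat \<Rightarrow> int set" where
  "left_insertion_increases \<Sigma> n =
     {int (cdawg_size (c # T)) - int (cdawg_size T) | c T.
        c \<in> \<Sigma> \<and> T \<in> lists \<Sigma> \<and> length T = n}"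

definition left_insertion_sensitivity :: "'a set \<Rightarrow> nat \<Rightarrow> int" where
  "left_insertion_sensitivity \<Sigma> n = Max (left_insertion_increases \<Sigma> n)"

lemma Substr_eq_set_sublists: "Substr T = set (sublists T)"
  by (auto simp: Substr_def)

lemma finite_maximal_substrs: "finite (maximal_substrs T)"
  by (rule finite_subset[of _ "Substr T"])
     (auto simp: maximal_substrs_def left_maximal_def Substr_eq_set_sublists)

lemma out_degree_le_length: "out_degree T w \<le> length T"
proof -
  have "{c. w @ [c] \<in> Substr T} \<subseteq> set T"
    by (auto simp: Substr_def sublist_def)
  then have "out_degree T w \<le> card (set T)"
    unfolding out_degree_def by (intro card_mono) auto
  then show ?thesis
    using card_length[of T] by linarith
qed

lemma cdawg_size_le: "cdawg_size T \<le> length (sublists T) * length T"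
proof -
  have "maximal_substrs T \<subseteq> set (sublists T)"
    by (auto simp: maximal_substrs_def left_maximal_def Substr_def)
  then have "card (maximal_substrs T) \<le> length (sublists T)"
    by (meson card_length card_mono finite_set le_trans)
  moreover have "cdawg_size T \<le> card (maximal_substrs T) * length T"
    unfolding cdawg_size_def
    using sum_bounded_above[of "maximal_substrs T" "out_degree T" "length T"]
    by (simp add: out_degree_le_length)
  ultimately show ?thesis
    by (meson le_trans mult_le_mono1)
qed

lemma finite_left_insertion_increases: "finite (left_insertion_increases \<Sigma> n)"
proof -
  define B where "B m = int (Suc (m * Suc m div 2) * m)" for m :: nat
  have B: "int (cdawg_size T) \<le> B (length T)" for T :: "'a list"
    using cdawg_size_le[of T] by (simp only: B_def length_sublists of_nat_le_iff)
  have "left_insertion_increases \<Sigma> n \<subseteq> {- B n .. B (Suc n)}"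
  proof
    fix x assume "x \<in> left_insertion_increases \<Sigma> n"
    then obtain c :: 'a and T where "x = int (cdawg_size (c # T)) - int (cdawg_size T)" "length T = n"
      unfolding left_insertion_increases_def by blast
    with B[of T] B[of "c # T"] show "x \<in> {- B n .. B (Suc n)}"
      by simp
  qed
  then show ?thesis
    by (rule finite_subset) simp
qed

end

theory Submission
  imports Defs
begin

text \<open>
  The family is \<open>T = (ab)\<^sup>m c (ab)\<^sup>m\<close> with \<open>m \<ge> 1\<close>. Since \<open>c\<close> occurs once and every
  nonempty \<open>c\<close>-free substring has at most one extension on either side by \<open>a\<close> or \<open>b\<close>, the
  maximal substrings of \<open>T\<close> other than \<open>\<epsilon>\<close> and \<open>T\<close> are the borders \<open>(ab)\<^sup>i\<close>, \<open>1 \<le> i \<le> m\<close>, of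
  \<open>(ab)\<^sup>m\<close>, and \<open>e(T) = 3 + 2(m - 1) + 1 + 0 = 2m + 2\<close>. Prepending \<open>b\<close> keeps these and makes
  each \<open>b(ab)\<^sup>i\<close> with \<open>i < m\<close> left-maximal as a prefix; these \<open>m\<close> new nodes have out-degree
  two, so \<open>e(bT) = 4m + 2\<close>.
\<close>

section \<open>Strings with a unique separator\<close>

text \<open>An occurrence of a word without \<open>c\<close> cannot cross the separator, so it lies
  on one side of it.\<close>

lemma sublist_separator_iff:
  assumes "c \<notin> set w"
  shows "sublist w (u @ c # v) \<longleftrightarrow> sublist w u \<or> sublist w v"
  using assms by (auto simp: sublist_append prefix_Cons sublist_Cons_right)

text \<open>The only \<open>c\<close> in the text fixes the alignment: \<open>p\<close> must end
  where \<open>u\<close> ends and \<open>q\<close> must start where \<open>v\<close> starts.\<close>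

lemma sublist_through_separator_iff:
  assumes "c \<notin> set u" "c \<notin> set v"
  shows "sublist (p @ c # q) (u @ c # v) \<longleftrightarrow> suffix p u \<and> prefix q v"
proof
  assume "sublist (p @ c # q) (u @ c # v)"
  then obtain ps ss where "u @ c # v = (ps @ p) @ c # (q @ ss)"
    by (auto simp: sublist_def)
  then have "u = ps @ p \<and> v = q @ ss"
    using assms append_Cons_eq_iff[of c u v] by blast
  then show "suffix p u \<and> prefix q v" by (auto simp: suffix_def)
next
  assume "suffix p u \<and> prefix q v"
  then obtain ps ss where "u = ps @ p" "v = q @ ss"
    by (auto simp: suffix_def prefix_def)
  then have "u @ c # v = ps @ (p @ c # q) @ ss" by simp
  then show "sublist (p @ c # q) (u @ c # v)" by (metis sublist_appendI)
qed

lemma sublist_self_snoc: "\<not> sublist (w @ [d]) w"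
  by (auto dest: sublist_length_le)

text \<open>Common shape of the string before the insertion (\<open>u = v\<close>) and after it
  (\<open>u = b # v\<close>). Determinism is asked of nonempty words only, since the empty word is
  extended by both \<open>a\<close> and \<open>b\<close>.\<close>

locale separated =
  fixes u v :: "'a list" and c :: 'a
  assumes c_notin: "c \<notin> set u"
    and suffix_vu: "suffix v u"
    and v_nonempty: "v \<noteq> []"
    and left_det: "\<lbrakk>w \<noteq> []; sublist (d # w) u; sublist (e # w) u\<rbrakk> \<Longrightarrow> d = e"
    and right_det: "\<lbrakk>w \<noteq> []; sublist (w @ [d]) u; sublist (w @ [e]) u\<rbrakk> \<Longrightarrow> d = e"
begin

lemma c_notin_v: "c \<notin> set v"
  using c_notin suffix_vu by (auto simp: suffix_def)

lemma sublist_iff: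
  assumes "c \<notin> set w"
  shows "sublist w (u @ c # v) \<longleftrightarrow> sublist w u"
  using sublist_separator_iff[OF assms, of u v] suffix_vu
  by (meson suffix_imp_sublist sublist_order.order_trans)

text \<open>Separates the two sources of a left neighbour: the separator, which precedes only
  prefixes of \<open>v\<close>, and the letters inside \<open>u\<close>.\<close>

lemma Cons_sublist_iff:
  assumes "c \<notin> set w"
  shows "sublist (d # w) (u @ c # v) \<longleftrightarrow> (if d = c then prefix w v else sublist (d # w) u)"
  using sublist_through_separator_iff[OF c_notin c_notin_v, of "[]" w] sublist_iff[of "d # w"] assms
  by auto

lemma snoc_sublist_iff:
  assumes "c \<notin> set w"
  shows "sublist (w @ [d]) (u @ c # v) \<longleftrightarrow> (if d = c then suffix w u else sublist (w @ [d]) u)"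
  using sublist_through_separator_iff[OF c_notin c_notin_v, of w "[]"] sublist_iff[of "w @ [d]"] assms
  by auto

lemma not_sublist_c: "c \<in> set w \<Longrightarrow> \<not> sublist w u"
  using c_notin set_mono_sublist by fastforce

text \<open>By \<open>left_det\<close>, \<open>u\<close> supplies at most one left neighbour. Two
  distinct ones therefore need \<open>c\<close> as the other, which forces \<open>w\<close> to start
  \<open>v\<close>.\<close>

lemma left_maximal_iff:
  assumes "c \<notin> set w" "w \<noteq> []"
  shows "left_maximal (u @ c # v) w \<longleftrightarrow> prefix w u \<or> prefix w v \<and> (\<exists>d. sublist (d # w) u)"
proof -
  have p: "prefix w (u @ c # v) \<longleftrightarrow> prefix w u"
    using assms by (auto simp: prefix_append prefix_Cons)
  have "(\<exists>d e. d \<noteq> e \<and> sublist (d # w) (u @ c # v) \<and> sublist (e # w) (u @ c # v))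
    \<longleftrightarrow> prefix w v \<and> (\<exists>d. sublist (d # w) u)" (is "?L \<longleftrightarrow> ?R")
  proof
    assume ?L then show ?R
      using left_det[OF assms(2)] by (auto simp: Cons_sublist_iff[OF assms(1)] split: if_splits)
  next
    assume R: ?R
    then obtain d where d: "sublist (d # w) u" by blast
    then have "d \<noteq> c" using not_sublist_c[of "d # w"] by auto
    then show ?L using d R Cons_sublist_iff[OF assms(1)] by metis
  qed
  moreover have "prefix w u \<or> (\<exists>d. sublist (d # w) u) \<Longrightarrow> sublist w (u @ c # v)"
    using sublist_iff[OF assms(1)] by (meson prefix_imp_sublist sublist_Cons_right
        sublist_order.order_trans sublist_order.order_refl)
  ultimately show ?thesis
    unfolding left_maximal_def Substr_def p by auto
qed

text \<open>Mirror image: \<open>u\<close> supplies at most one right neighbour, so a second one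
  must be \<open>c\<close>, which follows exactly the suffixes of \<open>u\<close>.\<close>

lemma right_maximal_iff:
  assumes "c \<notin> set w" "w \<noteq> []"
  shows "right_maximal (u @ c # v) w \<longleftrightarrow> suffix w v \<or> suffix w u \<and> (\<exists>d. sublist (w @ [d]) u)"
proof -
  have "c \<in> set w" if "suffix w (u @ c # v)" "\<not> suffix w v"
    using that by (auto simp: suffix_append suffix_Cons)
  moreover have "suffix w v \<Longrightarrow> suffix w (u @ c # v)"
    by (auto simp: suffix_append suffix_Cons)
  ultimately have p: "suffix w (u @ c # v) \<longleftrightarrow> suffix w v" using assms by blast
  have "(\<exists>d e. d \<noteq> e \<and> sublist (w @ [d]) (u @ c # v) \<and> sublist (w @ [e]) (u @ c # v))
    \<longleftrightarrow> suffix w u \<and> (\<exists>d. sublist (w @ [d]) u)" (is "?L \<longleftrightarrow> ?R")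
  proof
    assume ?L then show ?R
      using right_det[OF assms(2)] by (auto simp: snoc_sublist_iff[OF assms(1)] split: if_splits)
  next
    assume R: ?R
    then obtain d where d: "sublist (w @ [d]) u" by blast
    then have "d \<noteq> c" using not_sublist_c[of "w @ [d]"] by auto
    then show ?L using d R snoc_sublist_iff[OF assms(1)] by metis
  qed
  moreover have "suffix w v \<or> suffix w u \<Longrightarrow> sublist w (u @ c # v)"
    using sublist_iff[OF assms(1)] suffix_vu by (meson suffix_imp_sublist sublist_order.order_trans)
  ultimately show ?thesis
    unfolding right_maximal_def Substr_def p by auto
qed

text \<open>The single \<open>c\<close> pins the occurrence of \<open>w\<close>, so its neighbours
  are unique on both sides. Maximality then makes \<open>w\<close> both a prefix and a suffix of the
  text, and comparing the parts around \<open>c\<close> gives equality.\<close>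

lemma maximal_through_separator:
  assumes "w \<in> maximal_substrs (u @ c # v)" "c \<in> set w"
  shows "w = u @ c # v"
proof -
  obtain p q where w: "w = p @ c # q" using assms(2) by (meson split_list)
  note sub = sublist_through_separator_iff[OF c_notin c_notin_v]
  have lm: "left_maximal (u @ c # v) w" and rm: "right_maximal (u @ c # v) w"
    using assms(1) by (auto simp: maximal_substrs_def)
  have "d = e" if "sublist (d # w) (u @ c # v)" "sublist (e # w) (u @ c # v)" for d e
  proof -
    have "suffix (d # p) u" "suffix (e # p) u"
      using that sub[of "d # p" q] sub[of "e # p" q] by (auto simp: w)
    then show "d = e" by (auto simp: suffix_def)
  qed
  then have "prefix w (u @ c # v)"
    using lm by (auto simp: left_maximal_def Substr_def)
  moreover have "d = e" if "sublist (w @ [d]) (u @ c # v)" "sublist (w @ [e]) (u @ c # v)" for d e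
  proof -
    have "prefix (q @ [d]) v" "prefix (q @ [e]) v"
      using that sub[of p "q @ [d]"] sub[of p "q @ [e]"] by (auto simp: w)
    then show "d = e" by (auto simp: prefix_def)
  qed
  then have "suffix w (u @ c # v)"
    using rm by (auto simp: right_maximal_def Substr_def)
  ultimately obtain r s where "u @ c # v = p @ c # (q @ r)" "u @ c # v = (s @ p) @ c # q"
    by (auto simp: prefix_def suffix_def w)
  then have "u = p" "v = q"
    using append_Cons_eq_iff[OF c_notin c_notin_v] by blast+
  then show ?thesis by (simp add: w)
qed

lemma maximal_substrs_eq:
  "maximal_substrs (u @ c # v) = {[], u @ c # v} \<union>
     {w. w \<noteq> [] \<and> (prefix w u \<or> prefix w v \<and> (\<exists>d. sublist (d # w) u)) \<and>
         (suffix w v \<or> suffix w u \<and> (\<exists>d. sublist (w @ [d]) u))}"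
  (is "_ = ?A \<union> ?B")
proof (intro set_eqI iffI)
  fix w assume w: "w \<in> maximal_substrs (u @ c # v)"
  show "w \<in> ?A \<union> ?B"
  proof (cases "c \<in> set w \<or> w = []")
    case True
    then show ?thesis using maximal_through_separator[OF w] by auto
  next
    case False
    then show ?thesis
      using w left_maximal_iff[of w] right_maximal_iff[of w] by (auto simp: maximal_substrs_def)
  qed
next
  fix w assume w: "w \<in> ?A \<union> ?B"
  show "w \<in> maximal_substrs (u @ c # v)"
  proof (cases "w \<in> ?A")
    case True
    then show ?thesis
      by (auto simp: maximal_substrs_def left_maximal_def right_maximal_def Substr_def)
  next
    case False
    with w have B: "w \<in> ?B" by blast
    \<comment> \<open>Every word in \<open>?B\<close> is a prefix of \<open>u\<close> or of
      \<open>v\<close>, and both avoid \<open>c\<close>.\<close>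
    then have "c \<notin> set w"
      using c_notin c_notin_v by (auto dest!: set_mono_prefix set_mono_suffix)
    then show ?thesis
      using B left_maximal_iff[of w] right_maximal_iff[of w] by (auto simp: maximal_substrs_def)
  qed
qed

section \<open>Out-degrees of the nodes\<close>

lemma out_degree_Nil: "out_degree (u @ c # v) [] = Suc (card (set u))"
proof -
  have "{d. [d] \<in> Substr (u @ c # v)} = insert c (set u)"
  proof -
    have "sublist [d] w \<longleftrightarrow> d \<in> set w" for d :: 'a and w
      by (auto simp: sublist_def in_set_conv_decomp)
    then show ?thesis using suffix_vu by (auto simp: Substr_def dest: set_mono_suffix)
  qed
  then show ?thesis using c_notin by (simp add: out_degree_def)
qed

lemma out_degree_self: "out_degree (u @ c # v) (u @ c # v) = 0"
  using sublist_self_snoc[of "u @ c # v"] by (simp add: out_degree_def Substr_def)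

text \<open>The occurrence of \<open>w\<close> at the end of \<open>u\<close> is followed by
  \<open>c\<close>; inside \<open>u\<close>, \<open>right_det\<close> leaves \<open>d\<close> as the
  only successor.\<close>

lemma out_degree_two:
  assumes "w \<noteq> []" "suffix w u" "sublist (w @ [d]) u"
  shows "out_degree (u @ c # v) w = 2"
proof -
  have c: "c \<notin> set w" using assms(2) c_notin by (auto dest!: set_mono_suffix)
  have dc: "d \<noteq> c" using assms(3) not_sublist_c[of "w @ [d]"] by auto
  have "{e. w @ [e] \<in> Substr (u @ c # v)} = {c, d}"
    using assms right_det[OF assms(1)] dc by (auto simp: Substr_def snoc_sublist_iff[OF c])
  then show ?thesis using dc by (simp add: out_degree_def)
qed

lemma out_degree_one:
  assumes "suffix w u" "\<And>d. \<not> sublist (w @ [d]) u"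
  shows "out_degree (u @ c # v) w = 1"
proof -
  have c: "c \<notin> set w" using assms(1) c_notin by (auto dest!: set_mono_suffix)
  have "{e. w @ [e] \<in> Substr (u @ c # v)} = {c}"
    using assms by (auto simp: Substr_def snoc_sublist_iff[OF c])
  then show ?thesis by (simp add: out_degree_def)
qed

end

section \<open>Alternating strings\<close>

text \<open>Covers odd lengths and both starting letters, so that all substrings of
  \<open>(ab)^m\<close> and \<open>b(ab)^m\<close> have this form: these two are
  \<open>alt a b (2 * m)\<close> and \<open>alt b a (Suc (2 * m))\<close>.\<close>

fun alt :: "'a \<Rightarrow> 'a \<Rightarrow> nat \<Rightarrow> 'a list" where
  "alt x y 0 = []"
| "alt x y (Suc n) = x # alt y x n"

lemma length_alt [simp]: "length (alt x y n) = n"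
  by (induction n arbitrary: x y) auto

lemma set_alt: "set (alt x y n) \<subseteq> {x, y}"
  by (induction n arbitrary: x y) auto

lemma alt_eq_Nil [simp]: "alt x y n = [] \<longleftrightarrow> n = 0"
  by (cases n) auto

lemma alt_inject [simp]: "alt x y m = alt x y n \<longleftrightarrow> m = n"
  by (metis length_alt)

lemma alt_swap_eq [simp]: "x \<noteq> y \<Longrightarrow> alt x y m = alt y x n \<longleftrightarrow> m = 0 \<and> n = 0"
  by (cases m; cases n) auto

lemma alt_snoc: "alt x y (Suc n) = alt x y n @ [if even n then x else y]"
  by (induction n arbitrary: x y) auto

lemma prefix_alt_iff: "prefix w (alt x y n) \<longleftrightarrow> (\<exists>k\<le>n. w = alt x y k)"
proof (induction n arbitrary: w x y)
  case (Suc n)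
  have "(\<exists>k\<le>Suc n. w = alt x y k) \<longleftrightarrow> w = [] \<or> (\<exists>k\<le>n. w = x # alt y x k)"
    (is "?L \<longleftrightarrow> ?R")
  proof
    assume ?L
    then obtain k where "k \<le> Suc n" "w = alt x y k" by blast
    then show ?R by (cases k) auto
  next
    assume ?R
    then show ?L using alt.simps Suc_le_mono zero_le by metis
  qed
  then show ?case using Suc by (auto simp: prefix_Cons)
qed auto

text \<open>Each dropped letter swaps the roles of \<open>x\<close> and \<open>y\<close>, so the
  parity of \<open>n - k\<close> decides the first letter.\<close>

lemma suffix_alt_iff:
  "suffix w (alt x y n) \<longleftrightarrow> (\<exists>k\<le>n. w = (if even (n - k) then alt x y k else alt y x k))"
proof (induction n arbitrary: w x y)
  case (Suc n)
  have "(\<exists>k\<le>Suc n. w = (if even (Suc n - k) then alt x y k else alt y x k)) \<longleftrightarrow>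
     w = alt x y (Suc n) \<or> (\<exists>k\<le>n. w = (if even (n - k) then alt y x k else alt x y k))"
    (is "?L \<longleftrightarrow> _ \<or> ?R")
  proof -
    have "?L \<longleftrightarrow> w = alt x y (Suc n) \<or>
        (\<exists>k\<le>n. w = (if even (Suc n - k) then alt x y k else alt y x k))"
      by (metis le_Suc_eq diff_self_eq_0 even_zero le_refl)
    also have "(\<exists>k\<le>n. w = (if even (Suc n - k) then alt x y k else alt y x k)) \<longleftrightarrow> ?R"
      by (intro ex_cong1 conj_cong refl) (simp add: Suc_diff_le)
    finally show ?thesis .
  qed
  then show ?case using Suc by (simp add: suffix_Cons)
qed auto

text \<open>A nonempty substring starting with \<open>y\<close> must skip the leading
  \<open>x\<close>, hence the strict bound in the second case.\<close>

lemma sublist_alt_iff: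
  "sublist w (alt x y n) \<longleftrightarrow> (\<exists>k\<le>n. w = alt x y k) \<or> (\<exists>k<n. w = alt y x k)"
proof (induction n arbitrary: w x y)
  case (Suc n)
  have "sublist w (alt x y (Suc n)) \<longleftrightarrow> prefix w (alt x y (Suc n)) \<or> sublist w (alt y x n)"
    by (simp add: sublist_Cons_right)
  then show ?case
    unfolding prefix_alt_iff Suc.IH by (auto simp: less_Suc_eq_le)
qed auto

text \<open>Letters alternate, so the predecessor is the letter other than
  \<open>hd w\<close>.\<close>

lemma sublist_alt_left_det:
  assumes "x \<noteq> y" "w \<noteq> []" "sublist (d # w) (alt x y n)" "sublist (e # w) (alt x y n)"
  shows "d = e"
proof -
  have "d = (if hd w = x then y else x)" if sub: "sublist (d # w) (alt x y n)" for d
  proof -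
    obtain k where "d # w = alt x y k \<or> d # w = alt y x k"
      using sub unfolding sublist_alt_iff by blast
    moreover obtain l where "k = Suc (Suc l)"
      using calculation assms(2) by (cases k; cases "k - 1") auto
    ultimately show ?thesis using assms(1) by auto
  qed
  then show ?thesis using assms by blast
qed

text \<open>An alternating word is determined by its first letter and its length, and hence so is
  its last letter.\<close>

lemma sublist_alt_right_det:
  assumes "x \<noteq> y" "w \<noteq> []" "sublist (w @ [d]) (alt x y n)" "sublist (w @ [e]) (alt x y n)"
  shows "d = e"
proof -
  have "w @ [d] = alt (hd w) (if hd w = x then y else x) (Suc (length w))"
    if sub: "sublist (w @ [d]) (alt x y n)" for d
  proof -
    obtain k where k: "w @ [d] = alt x y k \<or> w @ [d] = alt y x k"
      using sub unfolding sublist_alt_iff by blast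
    then have "k = Suc (length w)" by (metis length_alt length_append_singleton)
    moreover have "hd (w @ [d]) = hd w" using assms(2) by simp
    ultimately show ?thesis using k assms(1) by auto
  qed
  then show ?thesis using assms by (metis last_snoc)
qed

lemma separated_alt:
  assumes "x \<noteq> y" "c \<notin> {x, y}" "suffix v (alt x y n)" "v \<noteq> []"
  shows "separated (alt x y n) v c"
  using assms set_alt[of x y n] sublist_alt_left_det[OF assms(1)] sublist_alt_right_det[OF assms(1)]
  by unfold_locales blast+

section \<open>The CDAWG sizes before and after the insertion\<close>

lemma card_set_alt:
  assumes "x \<noteq> y" "2 \<le> n"
  shows "card (set (alt x y n)) = 2"
proof -
  obtain k where "n = Suc (Suc k)"
    using assms(2) by (metis Suc_le_D Suc_le_mono numeral_2_eq_2)
  then have "set (alt x y n) = {x, y}" using set_alt[of x y k] by auto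
  then show ?thesis using assms(1) by simp
qed

lemma cdawg_size_alt:
  assumes "a \<noteq> b" "a \<noteq> c" "b \<noteq> c" "1 \<le> m"
  defines "v \<equiv> alt a b (2 * m)"
  shows "cdawg_size (v @ c # v) = 2 * m + 2"
proof -
  let ?T = "v @ c # v"
  interpret separated v v c
    unfolding v_def by (rule separated_alt) (use assms in auto)
  \<comment> \<open>For \<open>i < m\<close> the extended word has length \<open>2 * i + 1\<close>,
    which is still below \<open>2 * m\<close>.\<close>
  have ext: "sublist (alt a b (2 * i) @ [a]) v" if "i < m" for i
    using that alt_snoc[of a b "2 * i"] unfolding v_def sublist_alt_iff
    by (intro disjI1 exI[of _ "Suc (2 * i)"]) auto
  have suf: "suffix (alt a b (2 * i)) v" if "i \<le> m" for i
    using that unfolding v_def suffix_alt_iff by (intro exI[of _ "2 * i"]) auto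
  have "{w. w \<noteq> [] \<and> prefix w v \<and> suffix w v} = (\<lambda>i. alt a b (2 * i)) ` {1..m}"
    (is "?B = ?f ` _")
  proof (intro set_eqI iffI)
    fix w assume w: "w \<in> ?B"
    then obtain k where k: "w = alt a b k" "k \<le> 2 * m" "k \<noteq> 0"
      by (auto simp: v_def prefix_alt_iff)
    obtain l where l: "w = (if even (2 * m - l) then alt a b l else alt b a l)" "l \<le> 2 * m"
      using w by (auto simp: v_def suffix_alt_iff)
    \<comment> \<open>As a nonempty prefix of \<open>v\<close>, \<open>w\<close> starts with
      \<open>a\<close>; a nonempty suffix of \<open>v\<close> does so only if its length is
      even.\<close>
    have "even k" using k l assms(1) by (auto split: if_splits)
    then obtain i where "k = 2 * i" by blast
    then show "w \<in> ?f ` {1..m}" using k by auto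
  next
    fix w assume "w \<in> ?f ` {1..m}"
    then show "w \<in> ?B" using suf by (auto simp: v_def prefix_alt_iff)
  qed
  then have "maximal_substrs ?T = {[], ?T} \<union> ?f ` {1..m}"
    unfolding maximal_substrs_eq
    using prefix_order.order_trans suffix_imp_sublist by blast
  \<comment> \<open>The case \<open>i = m\<close>, which is \<open>v\<close> itself, is split off:
    only \<open>c\<close> can follow it, so its out-degree is 1 and not 2.\<close>
  also have "\<dots> = {[], ?T} \<union> (insert v (?f ` {1..<m}))"
    using assms(4) by (auto simp: v_def order_le_less)
  finally have M: "maximal_substrs ?T = {[], ?T} \<union> (insert v (?f ` {1..<m}))" .
  have f_len: "length (?f i) < length v" if "i < m" for i using that by (simp add: v_def)
  have "?T \<notin> insert v (?f ` {1..<m})" using f_len by (fastforce dest: arg_cong[where f = length])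
  moreover have "v \<notin> ?f ` {1..<m}" using f_len by fastforce
  moreover have "[] \<notin> insert v (?f ` {1..<m})" using v_nonempty by (auto simp: eq_commute[of "[]"])
  ultimately have "cdawg_size ?T = out_degree ?T [] + out_degree ?T ?T + out_degree ?T v
      + (\<Sum>w\<in>?f ` {1..<m}. out_degree ?T w)"
    unfolding cdawg_size_def M by (simp add: v_nonempty)
  also have "(\<Sum>w\<in>?f ` {1..<m}. out_degree ?T w) = (\<Sum>w\<in>?f ` {1..<m}. 2)"
    by (rule sum.cong) (auto intro!: out_degree_two[where d = a] suf ext)
  also have "\<dots> = 2 * (m - 1)"
    by (simp add: card_image inj_on_def)
  also have "out_degree ?T v = 1"
    by (rule out_degree_one) (auto simp: sublist_self_snoc)
  finally have "cdawg_size ?T = Suc (card (set v)) + 0 + 1 + 2 * (m - 1)"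
    by (simp only: out_degree_Nil out_degree_self)
  moreover have "card (set v) = 2"
    unfolding v_def using assms(1,4) by (intro card_set_alt) auto
  ultimately show ?thesis using assms(4) by simp
qed

text \<open>With \<open>u = b # v\<close>, prefixes of \<open>u\<close> also count as left-maximal,
  so now every nonempty suffix of \<open>v\<close> is a node: those of even length start with
  \<open>a\<close>, those of odd length with \<open>b\<close>.\<close>

lemma cdawg_size_Cons_alt:
  assumes "a \<noteq> b" "a \<noteq> c" "b \<noteq> c" "1 \<le> m"
  defines "v \<equiv> alt a b (2 * m)"
  shows "cdawg_size (b # v @ c # v) = 4 * m + 2"
proof -
  define u where "u = b # v"
  let ?T = "u @ c # v"
  have u: "u = alt b a (Suc (2 * m))" by (simp add: u_def v_def)
  interpret separated u v c
    unfolding u by (rule separated_alt) (use assms in \<open>auto simp: suffix_Cons\<close>)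
  have exta: "sublist (alt a b (2 * i) @ [a]) u" if "i < m" for i
    using that alt_snoc[of a b "2 * i"] unfolding u sublist_alt_iff
    by (intro disjI2 exI[of _ "Suc (2 * i)"]) auto
  have extb: "sublist (alt b a (Suc (2 * i)) @ [a]) u" if "i < m" for i
    using that alt_snoc[of b a "Suc (2 * i)"] unfolding u sublist_alt_iff
    by (intro disjI1 exI[of _ "Suc (Suc (2 * i))"]) auto
  have sufa: "suffix (alt a b (2 * i)) v" if "i \<le> m" for i
    using that unfolding v_def suffix_alt_iff by (intro exI[of _ "2 * i"]) auto
  have sufb: "suffix (alt b a (Suc (2 * i))) v" if "i < m" for i
    using that unfolding v_def suffix_alt_iff by (intro exI[of _ "Suc (2 * i)"]) auto
  let ?f = "\<lambda>i. alt a b (2 * i)" and ?g = "\<lambda>i. alt b a (Suc (2 * i))"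
  let ?B = "{w. w \<noteq> [] \<and> (prefix w u \<or> prefix w v) \<and> suffix w v}"
  have B: "?B = ?f ` {1..m} \<union> ?g ` {..<m}"
  proof (intro set_eqI iffI)
    fix w assume w: "w \<in> ?B"
    then obtain k where k: "w = alt a b k \<or> w = alt b a k"
      unfolding v_def u prefix_alt_iff by blast
    with w have "k \<noteq> 0" by auto
    obtain l where l: "w = (if even (2 * m - l) then alt a b l else alt b a l)" "l \<le> 2 * m"
      using w by (auto simp: v_def suffix_alt_iff)
    \<comment> \<open>Which letter starts \<open>w\<close> is left open here; comparing lengths
      suffices, and the parity of \<open>l\<close> then decides between \<open>?f\<close> and
      \<open>?g\<close>.\<close>
    have "k = l" using k l(1) by (metis length_alt)
    show "w \<in> ?f ` {1..m} \<union> ?g ` {..<m}"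
    proof (cases "even l")
      case True
      then obtain i where "l = 2 * i" by blast
      then show ?thesis using \<open>k \<noteq> 0\<close> l \<open>k = l\<close> by auto
    next
      case False
      then obtain i where i: "l = Suc (2 * i)" by (metis oddE Suc_eq_plus1)
      then have "i < m" "w = ?g i" using l by auto
      then show ?thesis by blast
    qed
  next
    fix w assume "w \<in> ?f ` {1..m} \<union> ?g ` {..<m}"
    then show "w \<in> ?B"
      using sufa sufb
      by (auto simp: v_def u prefix_alt_iff simp del: alt.simps)
  qed
  \<comment> \<open>The only suffix of \<open>u\<close> that is not a suffix of \<open>v\<close> is
    \<open>u\<close> itself, which is too long to be extended inside \<open>u\<close>.\<close>
  have "\<not> (suffix w u \<and> (\<exists>d. sublist (w @ [d]) u))" if "\<not> suffix w v" for w
    using that by (auto simp: u_def suffix_Cons dest: sublist_length_le)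
  \<comment> \<open>Each prefix of \<open>v\<close> is preceded in \<open>u\<close> by the inserted
    \<open>b\<close>, so the side condition on left neighbours holds automatically.\<close>
  moreover have "sublist (b # w) u" if "prefix w v" for w
    using that by (simp add: u_def sublist_Cons_right)
  ultimately have "maximal_substrs ?T = {[], ?T} \<union> ?B"
    unfolding maximal_substrs_eq by blast
  also have "\<dots> = {[], ?T} \<union> insert v (?f ` {1..<m} \<union> ?g ` {..<m})"
    unfolding B using assms(4)
    by (auto simp: v_def order_le_less simp del: alt.simps)
  finally have M: "maximal_substrs ?T = {[], ?T} \<union> insert v (?f ` {1..<m} \<union> ?g ` {..<m})" .
  let ?C = "?f ` {1..<m} \<union> ?g ` {..<m}"
  have len: "length w < length v" if "w \<in> ?C" for w using that by (auto simp: v_def)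
  have "length v < length ?T" by simp
  then have "?T \<notin> insert v ?C" using len by (metis insertE less_irrefl less_trans)
  moreover have "v \<notin> ?C" using len by blast
  moreover have "[] \<notin> insert v ?C" using v_nonempty by (auto simp: eq_commute[of "[]"])
  ultimately have "cdawg_size ?T = out_degree ?T [] + out_degree ?T ?T + out_degree ?T v
      + (\<Sum>w\<in>?C. out_degree ?T w)"
    unfolding cdawg_size_def M by (simp add: v_nonempty)
  also have "(\<Sum>w\<in>?C. out_degree ?T w) = (\<Sum>w\<in>?C. 2)"
  proof (rule sum.cong)
    fix w assume "w \<in> ?C"
    then have "w \<noteq> []" "suffix w v" "sublist (w @ [a]) u"
      using sufa sufb exta extb by (auto simp del: alt.simps simp: eq_commute[of "[]"])
    moreover have "suffix w u" using calculation(2) suffix_vu by (rule suffix_order.order_trans)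
    ultimately show "out_degree ?T w = 2" by (intro out_degree_two)
  qed simp
  also have "\<dots> = 2 * card ?C" by simp
  also have "card ?C = (m - 1) + m"
  proof -
    \<comment> \<open>Words in the first family start with \<open>a\<close>, those in the second
      with \<open>b\<close>.\<close>
    have "?f ` {1..<m} \<inter> ?g ` {..<m} = {}"
      using assms(1) by (auto simp del: alt.simps)
    then have "card ?C = card (?f ` {1..<m}) + card (?g ` {..<m})"
      by (intro card_Un_disjoint) auto
    then show ?thesis by (simp add: card_image inj_on_def)
  qed
  also have "out_degree ?T v = 1"
  \<comment> \<open>A word \<open>v @ [d]\<close> is as long as \<open>u\<close>, so it could only
    occur as \<open>u\<close>; but \<open>v\<close> starts with \<open>a\<close> and
    \<open>u\<close> with \<open>b\<close>.\<close>
  proof (rule out_degree_one[OF suffix_vu])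
    fix d show "\<not> sublist (v @ [d]) u"
    proof
      assume s: "sublist (v @ [d]) u"
      then obtain ps ss where split: "u = ps @ (v @ [d]) @ ss" by (auto simp: sublist_def)
      have "length u = Suc (length v)" by (simp add: u_def)
      then have "ps = [] \<and> ss = []" using split by auto
      then have "v @ [d] = u" using split by simp
      then have "hd v = b" using v_nonempty by (metis hd_append2 list.sel(1) u_def)
      moreover have "hd v = a" using assms(4) by (cases "2 * m") (auto simp: v_def)
      ultimately show False using assms(1) by simp
    qed
  qed
  finally have "cdawg_size ?T = Suc (card (set u)) + 0 + 1 + 2 * (m - 1 + m)"
    by (simp only: out_degree_Nil out_degree_self)
  moreover have "card (set u) = 2"
    unfolding u using assms(1,4) by (intro card_set_alt) auto
  ultimately have "cdawg_size ?T = 4 * m + 2" using assms(4) by simp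
  then show ?thesis by (simp add: u_def)
qed

section \<open>The infinite family and the sensitivity bound\<close>

theorem theorem2:
  fixes \<Sigma> :: "'a set"
  assumes "\<exists>x\<in>\<Sigma>. \<exists>y\<in>\<Sigma>. \<exists>z\<in>\<Sigma>. x \<noteq> y \<and> x \<noteq> z \<and> y \<noteq> z"
  shows "\<exists>b\<in>\<Sigma>. \<exists>F. F \<subseteq> lists \<Sigma> \<and> infinite F
           \<and> (\<forall>N. \<exists>T\<in>F. N \<le> length T \<and> N \<le> cdawg_size T)
           \<and> (\<forall>T\<in>F. int (cdawg_size (b # T)) - int (cdawg_size T) = int (cdawg_size T) - 2)
           \<and> (\<forall>T\<in>F. left_insertion_sensitivity \<Sigma> (length T) \<ge> int (cdawg_size T) - 2)"
proof -
  obtain a b c where abc: "a \<in> \<Sigma>" "b \<in> \<Sigma>" "c \<in> \<Sigma>" "a \<noteq> b" "a \<noteq> c" "b \<noteq> c"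
    using assms by blast
  define T where "T m = alt a b (2 * m) @ c # alt a b (2 * m)" for m
  define F where "F = T ` {1..}"
  have lists: "F \<subseteq> lists \<Sigma>"
    using set_alt[of a b] abc by (fastforce simp: F_def T_def)
  have len: "length (T m) = 4 * m + 1" for m by (simp add: T_def)
  \<comment> \<open>Distinct indices give distinct lengths \<open>4 * m + 1\<close>.\<close>
  have "inj T" by (rule injI) (metis len add_right_cancel mult_left_cancel zero_neq_numeral)
  then have inf: "infinite F"
    unfolding F_def by (simp add: finite_image_iff inj_on_subset infinite_Ici)
  have size: "cdawg_size (T m) = 2 * m + 2" "cdawg_size (b # T m) = 4 * m + 2" if "1 \<le> m" for m
    using cdawg_size_alt[OF abc(4-6) that] cdawg_size_Cons_alt[OF abc(4-6) that]
    by (simp_all add: T_def)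
  \<comment> \<open>The index \<open>Suc N\<close> is at least 1, and both the length
    \<open>4 * N + 5\<close> and the size \<open>2 * N + 4\<close> exceed \<open>N\<close>.\<close>
  have unbounded: "\<exists>T\<in>F. N \<le> length T \<and> N \<le> cdawg_size T" for N
    unfolding F_def using size[of "Suc N"] by (intro bexI[of _ "T (Suc N)"]) (auto simp: len)
  have incr: "int (cdawg_size (b # S)) - int (cdawg_size S) = int (cdawg_size S) - 2"
    if "S \<in> F" for S
    using that size by (auto simp: F_def)
  have "int (cdawg_size S) - 2 \<le> left_insertion_sensitivity \<Sigma> (length S)" if "S \<in> F" for S
    \<comment> \<open>Reading \<open>incr\<close> backwards turns the bound into the increase caused
      by \<open>b\<close>, which is one of the values under the maximum.\<close>
    unfolding left_insertion_sensitivity_def incr[OF that, symmetric]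
    by (rule Max_ge[OF finite_left_insertion_increases])
       (use that lists abc in \<open>auto simp: left_insertion_increases_def\<close>)
  then show ?thesis
    using abc(2) lists inf unbounded incr by blast
qed

end
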